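(* Let $V$ be a finite-dimensional real vector space and let $\mathcal{C}$ be an open convex cone in $V$. Fix $\beta>0$, and let $A,B,C,D\colon\mathcal{C}\to(0,\infty)$. Suppose that $(A+By)^{-\beta}$ and $(C+Dy)^{-\beta}$ are completely monotone on $\mathcal{C}\times(0,\infty)$. Then the same is true of $(AD+BC+BDy)^{-\beta}$.
   Context: Here $A,B,C,D$ are functions of $x\in\mathcal{C}$ and $y$ is the variable in $(0,\infty)$; $\mathcal{C}\times(0,\infty)$ is an open convex cone in $V\oplus\mathbb{R}$. For an open convex cone $K$ in a finite-dimensional real vector space, a $C^\infty$ function $f\colon K\to\mathbb{R}$ is completely monotone if for all $k\ge 0$, all $\mathbf{u}_1,\ldots,\mathbf{u}_k\in K$ and all $\mathbf{x}\in K$, one has $(-1)^kD_{\mathbf{u}_1}\cdots D_{\mathbf{u}_k}f(\mathbf{x})\ge 0$, where $D_{\mathbf{u}}$ is the directional derivative. *)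

theory Defs
  imports "HOL-Analysis.Analysis"
begin

text \<open>The library predicates \<open>cone\<close> and \<open>conic\<close> are closed under scaling by \<open>0\<close> as well, so
  the only nonempty open set satisfying them is the whole space; an open cone is closed under
  scaling by positive reals only.\<close>

definition open_convex_cone :: "'a::real_normed_vector set \<Rightarrow> bool" where
  "open_convex_cone K \<longleftrightarrow> open K \<and> convex K \<and> (\<forall>x\<in>K. \<forall>c>0. c *\<^sub>R x \<in> K)"

definition dir_deriv :: "'a::real_normed_vector \<Rightarrow> ('a \<Rightarrow> real) \<Rightarrow> 'a \<Rightarrow> real" where
  "dir_deriv u f x = deriv (\<lambda>t. f (x + t *\<^sub>R u)) 0"

text \<open>\<open>C_k_on k K f\<close>: on an open subset \<open>K\<close> of a finite-dimensional space, \<open>f\<close> is \<open>k\<close> times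
  continuously differentiable. Continuity of the derivative as a linear map is expressed by
  continuity of all directional derivatives, which is equivalent in finite dimension.
  Values of \<open>f\<close> outside \<open>K\<close> are irrelevant since \<open>K\<close> is open.\<close>

primrec C_k_on :: "nat \<Rightarrow> 'a::real_normed_vector set \<Rightarrow> ('a \<Rightarrow> real) \<Rightarrow> bool" where
  "C_k_on 0 K f \<longleftrightarrow> continuous_on K f"
| "C_k_on (Suc k) K f \<longleftrightarrow>
     (\<forall>x\<in>K. f differentiable (at x)) \<and> (\<forall>u. C_k_on k K (dir_deriv u f))"

definition C_infinity_on :: "'a::real_normed_vector set \<Rightarrow> ('a \<Rightarrow> real) \<Rightarrow> bool" where
  "C_infinity_on K f \<longleftrightarrow> (\<forall>k. C_k_on k K f)"

text \<open>The list \<open>us = [u\<^sub>1, \<dots>, u\<^sub>k]\<close> gives the directions of the iterated derivative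
  \<open>D u\<^sub>1 (\<dots> (D u\<^sub>k f))\<close>. Intended for \<open>K\<close> an open convex cone.\<close>

definition completely_monotone_on :: "'a::real_normed_vector set \<Rightarrow> ('a \<Rightarrow> real) \<Rightarrow> bool" where
  "completely_monotone_on K f \<longleftrightarrow>
     C_infinity_on K f \<and>
     (\<forall>us x. set us \<subseteq> K \<longrightarrow> x \<in> K \<longrightarrow> (-1) ^ length us * foldr dir_deriv us f x \<ge> 0)"

end

theory Submission
  imports Defs "HOL-Real_Asymp.Real_Asymp"
begin

text \<open>Complete monotonicity of a smooth function on an open convex cone is equivalent to the
  alternation of all finite differences with steps in the cone, and the latter property survives
  products and pointwise limits without any control of derivatives. The derivatives of
  \<open>(A + B y) powr (- \<beta>)\<close> with respect to \<open>y\<close> are explicit, and by the Post-Widder inversion formula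
  suitable multiples of them converge to \<open>B powr (- \<beta>) * exp (- t * (A / B + y))\<close>, which
  therefore has alternating differences for all \<open>t > 0\<close>. Multiplying with the analogous function
  of \<open>C\<close> and \<open>D\<close> and superposing over \<open>t\<close> gives
  \<open>(B D) powr (- \<beta>) * (A / B + C / D + 2 y) powr (- \<beta>) = (A D + B C + 2 B D y) powr (- \<beta>)\<close>,
  and the factor \<open>2\<close> is removed by rescaling \<open>y\<close>. Smoothness is
  inherited because \<open>A + B y\<close> is a power of a smooth function and \<open>B\<close> is its derivative.\<close>

section \<open>Smooth functions\<close>

lemma has_real_derivative_line:
  assumes "(f has_derivative f') (at (x + s *\<^sub>R u))"
  shows "((\<lambda>t. f (x + t *\<^sub>R u)) has_real_derivative f' u) (at s)"
proof -
  interpret f': bounded_linear f' using assms by (rule has_derivative_bounded_linear)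
  have "((\<lambda>t. x + t *\<^sub>R u) has_derivative (\<lambda>t. t *\<^sub>R u)) (at s)"
    by (auto intro!: derivative_eq_intros)
  from has_derivative_compose[OF this assms] show ?thesis
    by (simp add: has_field_derivative_def f'.scale mult_commute_abs)
qed

lemma dir_deriv_eq:
  assumes "(f has_derivative f') (at x)"
  shows "dir_deriv u f x = f' u"
  using has_real_derivative_line[of f f' x 0 u] assms
  unfolding dir_deriv_def by (auto intro: DERIV_imp_deriv)

lemma has_real_derivative_dir_deriv:
  assumes "f differentiable at (x + s *\<^sub>R u)"
  shows "((\<lambda>t. f (x + t *\<^sub>R u)) has_real_derivative dir_deriv u f (x + s *\<^sub>R u)) (at s)"
proof -
  obtain f' where f': "(f has_derivative f') (at (x + s *\<^sub>R u))"
    using assms by (auto simp: differentiable_def)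
  from has_real_derivative_line[OF f'] show ?thesis by (simp add: dir_deriv_eq[OF f'])
qed

lemma dir_deriv_translate: "dir_deriv u (\<lambda>x. f (x + v)) x = dir_deriv u f (x + v)"
  by (simp add: dir_deriv_def algebra_simps)

lemma dir_deriv_cong_open:
  assumes "open K" "x \<in> K" "\<And>y. y \<in> K \<Longrightarrow> f y = g y"
  shows "dir_deriv u f x = dir_deriv u g x"
proof -
  have "((\<lambda>t. x + t *\<^sub>R u) \<longlongrightarrow> x + 0 *\<^sub>R u) (nhds 0)"
    by (intro tendsto_intros filterlim_ident)
  then have "\<forall>\<^sub>F t in nhds 0. x + t *\<^sub>R u \<in> K"
    using assms(1,2) by (auto dest: topological_tendstoD)
  then have "\<forall>\<^sub>F t in nhds 0. f (x + t *\<^sub>R u) = g (x + t *\<^sub>R u)"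
    by eventually_elim (simp add: assms(3))
  then show ?thesis unfolding dir_deriv_def by (rule deriv_cong_ev) simp
qed

lemma differentiable_cong_open:
  assumes "open K" "x \<in> K" "\<And>y. y \<in> K \<Longrightarrow> f y = g y" "f differentiable (at x)"
  shows "g differentiable (at x)"
  using assms has_derivative_transform_within_open[OF _ assms(1,2)]
  unfolding differentiable_def by metis

text \<open>The rules below compute directional derivatives of sums, products and powers only at
  points of \<open>K\<close>, while \<open>C_k_on\<close> recurses on functions defined everywhere.
  Openness of \<open>K\<close> makes the outside values irrelevant at every order.\<close>

lemma C_k_on_cong:
  assumes "open K" "\<And>x. x \<in> K \<Longrightarrow> f x = g x" "C_k_on k K f"
  shows "C_k_on k K g"
  using assms(2,3)
proof (induction k arbitrary: f g)
  case 0
  then show ?case using continuous_on_cong[of K K f g] by simp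
next
  case (Suc k)
  have "C_k_on k K (dir_deriv u g)" for u
  proof (rule Suc.IH)
    show "C_k_on k K (dir_deriv u f)" using Suc.prems(2) by simp
    show "dir_deriv u f x = dir_deriv u g x" if "x \<in> K" for x
      using assms(1) that Suc.prems(1) by (rule dir_deriv_cong_open)
  qed
  moreover have "g differentiable (at x)" if "x \<in> K" for x
    using differentiable_cong_open[OF assms(1) that Suc.prems(1)] Suc.prems(2) that by simp
  ultimately show ?case by simp
qed

text \<open>For positive order the definition does not ask for continuity of \<open>f\<close>
  itself; the base case gets it from differentiability. The product and power rules rely on this,
  because their derivatives contain undifferentiated factors.\<close>

lemma C_k_on_SucD:
  assumes "C_k_on (Suc k) K f"
  shows "C_k_on k K f"
  using assms
proof (induction k arbitrary: f)
  case 0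
  then show ?case
    by (auto intro!: continuous_at_imp_continuous_on differentiable_imp_continuous_within)
next
  case (Suc k)
  show ?case unfolding C_k_on.simps
  proof (intro conjI allI)
    show "\<forall>x\<in>K. f differentiable at x" using Suc.prems by simp
    show "C_k_on k K (dir_deriv u f)" for u
    proof (rule Suc.IH)
      show "C_k_on (Suc k) K (dir_deriv u f)"
        using Suc.prems C_k_on.simps(2)[of "Suc k" K f] by blast
    qed
  qed
qed

lemma C_k_on_const: "C_k_on k K (\<lambda>x. c)"
proof (induction k arbitrary: c)
  case (Suc k)
  have "dir_deriv u (\<lambda>x. c) = (\<lambda>x. 0)" for u :: 'a by (auto simp: dir_deriv_def)
  then show ?case using Suc by simp
qed simp

lemma C_k_on_bounded_linear:
  assumes "bounded_linear f"
  shows "C_k_on k K f"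
proof (cases k)
  case 0
  then show ?thesis using assms by (simp add: linear_continuous_on)
next
  case (Suc n)
  have d: "(f has_derivative f) (at x)" for x
    using assms by (rule bounded_linear_imp_has_derivative)
  then have "dir_deriv u f = (\<lambda>x. f u)" for u by (auto simp: dir_deriv_eq[OF d])
  then show ?thesis using d Suc by (auto simp: differentiable_def C_k_on_const)
qed

lemma C_k_on_add:
  assumes "open K" "C_k_on k K f" "C_k_on k K g"
  shows "C_k_on k K (\<lambda>x. f x + g x)"
  using assms(2,3)
proof (induction k arbitrary: f g)
  case 0
  then show ?case by (simp add: continuous_on_add)
next
  case (Suc k)
  have *: "dir_deriv u (\<lambda>x. f x + g x) x = dir_deriv u f x + dir_deriv u g x" if "x \<in> K" for u x
  proof -
    have "f differentiable (at x)" "g differentiable (at x)" using Suc.prems that by simp_all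
    then obtain f' g' where d: "(f has_derivative f') (at x)" "(g has_derivative g') (at x)"
      unfolding differentiable_def by blast
    show ?thesis
      using dir_deriv_eq[OF has_derivative_add[OF d]] by (simp add: d[THEN dir_deriv_eq])
  qed
  have **: "C_k_on k K (\<lambda>x. dir_deriv u f x + dir_deriv u g x)" for u
    using Suc.prems by (intro Suc.IH) auto
  have "C_k_on k K (dir_deriv u (\<lambda>x. f x + g x))" for u
    by (rule C_k_on_cong[OF assms(1) _ **[of u]]) (simp add: *)
  then show ?case using Suc.prems by auto
qed

lemma C_k_on_mult:
  assumes "open K" "C_k_on k K f" "C_k_on k K g"
  shows "C_k_on k K (\<lambda>x. f x * g x)"
  using assms(2,3)
proof (induction k arbitrary: f g)
  case 0
  then show ?case by (simp add: continuous_on_mult)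
next
  case (Suc k)
  have *: "dir_deriv u (\<lambda>x. f x * g x) x = f x * dir_deriv u g x + dir_deriv u f x * g x"
    if "x \<in> K" for u x
  proof -
    have "f differentiable (at x)" "g differentiable (at x)" using Suc.prems that by simp_all
    then obtain f' g' where d: "(f has_derivative f') (at x)" "(g has_derivative g') (at x)"
      unfolding differentiable_def by blast
    show ?thesis
      using dir_deriv_eq[OF has_derivative_mult[OF d]] by (simp add: d[THEN dir_deriv_eq])
  qed
  have "C_k_on k K f" "C_k_on k K g" using Suc.prems[THEN C_k_on_SucD] .
  then have **: "C_k_on k K (\<lambda>x. f x * dir_deriv u g x + dir_deriv u f x * g x)" for u
    using Suc.prems by (intro C_k_on_add[OF assms(1)] Suc.IH) simp_all
  have "C_k_on k K (dir_deriv u (\<lambda>x. f x * g x))" for u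
    by (rule C_k_on_cong[OF assms(1) _ **[of u]]) (simp add: *)
  then show ?case using Suc.prems by (auto intro!: differentiable_mult)
qed

lemma C_k_on_diff:
  assumes "open K" "C_k_on k K f" "C_k_on k K g"
  shows "C_k_on k K (\<lambda>x. f x - g x)"
  using C_k_on_add[OF assms(1,2) C_k_on_mult[OF assms(1) C_k_on_const[of _ _ "-1"] assms(3)]]
  by simp

text \<open>The derivative carries the exponent \<open>p - 1\<close>, so the induction has to cover
  all exponents at once.\<close>

lemma C_k_on_powr:
  assumes "open K" "C_k_on k K f" "\<And>x. x \<in> K \<Longrightarrow> f x > 0"
  shows "C_k_on k K (\<lambda>x. f x powr p)"
  using assms(2,3)
proof (induction k arbitrary: p)
  case 0
  then have "\<forall>x\<in>K. f x \<noteq> 0" by (metis less_irrefl)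
  then show ?case using 0 continuous_on_powr[of K f "\<lambda>_. p"] by (simp add: continuous_on_const)
next
  case (Suc k)
  have d: "((\<lambda>x. f x powr p) has_derivative (\<lambda>h. p * f x powr (p - 1) * f' h)) (at x)"
    if "x \<in> K" "(f has_derivative f') (at x)" for x f'
  proof -
    have "((\<lambda>y. y powr p) has_derivative (\<lambda>h. h * (p * f x powr (p - 1)))) (at (f x))"
      using has_real_derivative_powr[OF Suc.prems(2)[OF that(1)], of p]
      by (simp add: has_field_derivative_def mult_commute_abs)
    from has_derivative_compose[OF that(2) this] show ?thesis by (simp add: mult_ac)
  qed
  have *: "dir_deriv u (\<lambda>x. f x powr p) x = p * f x powr (p - 1) * dir_deriv u f x"
    if "x \<in> K" for u x
  proof -
    have "f differentiable (at x)" using Suc.prems that by simp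
    then obtain f' where f': "(f has_derivative f') (at x)"
      unfolding differentiable_def by blast
    show ?thesis using dir_deriv_eq[OF d[OF that f']] dir_deriv_eq[OF f'] by simp
  qed
  have "C_k_on k K f" using Suc.prems(1) by (rule C_k_on_SucD)
  then have **: "C_k_on k K (\<lambda>x. p * f x powr (p - 1) * dir_deriv u f x)" for u
    using Suc.prems by (intro C_k_on_mult[OF assms(1)] C_k_on_const Suc.IH) simp_all
  have "C_k_on k K (dir_deriv u (\<lambda>x. f x powr p))" for u
    by (rule C_k_on_cong[OF assms(1) _ **[of u]]) (simp add: *)
  moreover have "(\<lambda>x. f x powr p) differentiable (at x)" if "x \<in> K" for x
    using Suc.prems(1) that d[OF that] C_k_on.simps(2) unfolding differentiable_def by blast
  ultimately show ?case by simp
qed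

lemma C_k_on_translate:
  assumes "C_k_on k K f" "\<And>x. x \<in> K \<Longrightarrow> x + u \<in> K"
  shows "C_k_on k K (\<lambda>x. f (x + u))"
  using assms(1)
proof (induction k arbitrary: f)
  case 0
  then show ?case
    using assms(2) continuous_on_compose2[of K f K "\<lambda>x. x + u"]
    by (auto simp: continuous_on_add continuous_on_id continuous_on_const)
next
  case (Suc k)
  have "(\<lambda>x. f (x + u)) differentiable (at x)" if "x \<in> K" for x
    using Suc.prems assms(2)[OF that]
    by (intro differentiable_compose[of f "\<lambda>x. x + u"]) auto
  moreover have "C_k_on k K (dir_deriv v (\<lambda>x. f (x + u)))" for v
    using Suc.IH[of "dir_deriv v f"] Suc.prems by (simp add: dir_deriv_translate[abs_def])
  ultimately show ?case by simp
qed

lemma C_infinity_on_Suc_iff: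
  "C_infinity_on K f \<longleftrightarrow> (\<forall>x\<in>K. f differentiable (at x)) \<and> (\<forall>u. C_infinity_on K (dir_deriv u f))"
proof
  assume "C_infinity_on K f"
  then have "C_k_on (Suc k) K f" for k unfolding C_infinity_on_def by blast
  then show "(\<forall>x\<in>K. f differentiable (at x)) \<and> (\<forall>u. C_infinity_on K (dir_deriv u f))"
    by (simp add: C_infinity_on_def)
next
  assume "(\<forall>x\<in>K. f differentiable (at x)) \<and> (\<forall>u. C_infinity_on K (dir_deriv u f))"
  then have "C_k_on (Suc k) K f" for k by (simp add: C_infinity_on_def)
  from C_k_on_SucD[OF this] show "C_infinity_on K f" by (simp add: C_infinity_on_def)
qed

lemma C_infinity_on_foldr_dir_deriv:
  assumes "C_infinity_on K f"
  shows "C_infinity_on K (foldr dir_deriv us f)"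
proof (induction us)
  case (Cons u us)
  from C_infinity_on_Suc_iff[THEN iffD1, OF this] show ?case by simp
qed (simp add: assms)

lemma C_infinity_on_differentiable:
  assumes "C_infinity_on K f" "x \<in> K"
  shows "f differentiable (at x)"
  using C_infinity_on_Suc_iff[THEN iffD1, OF assms(1)] assms(2) by simp

lemma C_infinity_on_continuous_on:
  assumes "C_infinity_on K f"
  shows "continuous_on K f"
  using assms C_k_on.simps(1) unfolding C_infinity_on_def by blast

section \<open>Alternating finite differences\<close>

text \<open>The difference \<open>f x - f (x + u)\<close> is a discrete version of minus the
  derivative along \<open>u\<close>, so no sign factor appears. Nonnegativity is kept at every
  stage, so that a level implies all lower ones; the product rule depends on this.\<close>

primrec diff_monotone :: "nat \<Rightarrow> 'a::ab_group_add set \<Rightarrow> ('a \<Rightarrow> real) \<Rightarrow> bool" where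
  "diff_monotone 0 K f \<longleftrightarrow> (\<forall>x\<in>K. f x \<ge> 0)"
| "diff_monotone (Suc n) K f \<longleftrightarrow>
     (\<forall>x\<in>K. f x \<ge> 0) \<and> (\<forall>u\<in>K. diff_monotone n K (\<lambda>x. f x - f (x + u)))"

lemma diff_monotone_nonneg: "diff_monotone n K f \<Longrightarrow> x \<in> K \<Longrightarrow> f x \<ge> 0"
  by (cases n) auto

lemma diff_monotone_SucD: "diff_monotone (Suc n) K f \<Longrightarrow> diff_monotone n K f"
proof (induction n arbitrary: f)
  case (Suc n)
  have "diff_monotone n K (\<lambda>x. f x - f (x + u))" if "u \<in> K" for u
    using Suc.prems that by (intro Suc.IH) (simp only: diff_monotone.simps(2)[of "Suc n"])
  moreover have "\<forall>x\<in>K. f x \<ge> 0" using Suc.prems diff_monotone_nonneg by blast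
  ultimately show ?case by simp
qed simp

text \<open>Unfolded, the condition is a family of weak inequalities, each involving finitely many
  points of \<open>K\<close>, so it passes to pointwise limits. A general filter serves both
  sequences and limits along \<open>at_right 0\<close>.\<close>

lemma diff_monotone_tendsto:
  assumes "F \<noteq> bot" "\<forall>\<^sub>F i in F. diff_monotone n K (g i)"
    and "\<And>x. x \<in> K \<Longrightarrow> ((\<lambda>i. g i x) \<longlongrightarrow> f x) F"
    and "\<And>x u. x \<in> K \<Longrightarrow> u \<in> K \<Longrightarrow> x + u \<in> K"
  shows "diff_monotone n K f"
  using assms(2,3)
proof (induction n arbitrary: f g)
  case 0
  have "f x \<ge> 0" if "x \<in> K" for x
    by (rule tendsto_lowerbound[OF 0(2)[OF that] eventually_mono[OF 0(1)] assms(1)])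
      (rule diff_monotone_nonneg[OF _ that])
  then show ?case by simp
next
  case (Suc n)
  have "f x \<ge> 0" if "x \<in> K" for x
    by (rule tendsto_lowerbound[OF Suc.prems(2)[OF that] eventually_mono[OF Suc.prems(1)] assms(1)])
      (rule diff_monotone_nonneg[OF _ that])
  moreover have "diff_monotone n K (\<lambda>x. f x - f (x + u))" if "u \<in> K" for u
  proof (rule Suc.IH)
    show "\<forall>\<^sub>F i in F. diff_monotone n K (\<lambda>x. g i x - g i (x + u))"
      using Suc.prems(1) by eventually_elim (simp add: that)
    show "((\<lambda>i. g i x - g i (x + u)) \<longlongrightarrow> f x - f (x + u)) F" if "x \<in> K" for x
      using that \<open>u \<in> K\<close> by (intro tendsto_diff Suc.prems(2) assms(4))
  qed
  ultimately show ?case by simp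
qed

lemma diff_monotone_cong:
  assumes "diff_monotone n K f" "\<And>x. x \<in> K \<Longrightarrow> f x = g x"
    and "\<And>x u. x \<in> K \<Longrightarrow> u \<in> K \<Longrightarrow> x + u \<in> K"
  shows "diff_monotone n K g"
  \<comment> \<open>A function agreeing with \<open>f\<close> on \<open>K\<close> is there the
    pointwise limit of the constant sequence \<open>f\<close>.\<close>
  using diff_monotone_tendsto[of sequentially n K "\<lambda>_. f" g] assms by simp

lemma diff_monotone_translate:
  assumes "diff_monotone n K f" "\<And>x. x \<in> K \<Longrightarrow> x + v \<in> K"
  shows "diff_monotone n K (\<lambda>x. f (x + v))"
  using assms(1)
proof (induction n arbitrary: f)
  case 0
  then show ?case using assms(2) by simp
next
  case (Suc n)
  have "diff_monotone n K (\<lambda>x. f (x + v) - f (x + u + v))" if "u \<in> K" for u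
    using Suc.IH[of "\<lambda>x. f x - f (x + u)"] Suc.prems that
    by (simp add: add.assoc add.commute[of v u])
  then show ?case using Suc.prems assms(2) by simp
qed

text \<open>Additivity turns the step \<open>u\<close> into the step \<open>L u\<close>, which is
  again in \<open>K\<close>.\<close>

lemma diff_monotone_linear_comp:
  assumes "diff_monotone n K f" "\<And>x. x \<in> K \<Longrightarrow> L x \<in> K" "\<And>x y. L (x + y) = L x + L y"
  shows "diff_monotone n K (\<lambda>x. f (L x))"
  using assms(1)
proof (induction n arbitrary: f)
  case 0
  then show ?case using assms(2) by simp
next
  case (Suc n)
  have "diff_monotone n K (\<lambda>x. f (L x) - f (L (x + u)))" if "u \<in> K" for u
    using Suc.IH[of "\<lambda>x. f x - f (x + L u)"] Suc.prems that assms(2,3) by simp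
  then show ?case using Suc.prems assms(2) by simp
qed

lemma diff_monotone_add:
  assumes "diff_monotone n K f" "diff_monotone n K g"
  shows "diff_monotone n K (\<lambda>x. f x + g x)"
  using assms
proof (induction n arbitrary: f g)
  case (Suc n)
  have "diff_monotone n K (\<lambda>x. f x + g x - (f (x + u) + g (x + u)))" if "u \<in> K" for u
    using Suc.IH[of "\<lambda>x. f x - f (x + u)" "\<lambda>x. g x - g (x + u)"] Suc.prems that
    by (simp add: add_diff_add)
  then show ?case using Suc.prems by simp
qed simp

lemma diff_monotone_cmult:
  assumes "diff_monotone n K f" "c \<ge> 0"
  shows "diff_monotone n K (\<lambda>x. c * f x)"
  using assms(1)
proof (induction n arbitrary: f)
  case (Suc n)
  have "diff_monotone n K (\<lambda>x. c * f x - c * f (x + u))" if "u \<in> K" for u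
    using Suc.IH[of "\<lambda>x. f x - f (x + u)"] Suc.prems that
    by (simp add: right_diff_distrib)
  then show ?case using Suc.prems assms(2) by simp
qed (use assms(2) in simp)

lemma diff_monotone_zero: "diff_monotone n K (\<lambda>x. 0)"
  by (induction n) auto

lemma diff_monotone_sum:
  assumes "\<And>i. i \<in> I \<Longrightarrow> diff_monotone n K (f i)"
  shows "diff_monotone n K (\<lambda>x. \<Sum>i\<in>I. f i x)"
  using assms
  by (induction I rule: infinite_finite_induct) (auto intro: diff_monotone_add diff_monotone_zero)

text \<open>A discrete Leibniz rule: the difference of the product is
  \<open>(f x - f (x + u)) * g x + f (x + u) * (g x - g (x + u))\<close>, and all four factors have
  the lower level.\<close>

lemma diff_monotone_mult:
  assumes "diff_monotone n K f" "diff_monotone n K g"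
    and "\<And>x u. x \<in> K \<Longrightarrow> u \<in> K \<Longrightarrow> x + u \<in> K"
  shows "diff_monotone n K (\<lambda>x. f x * g x)"
  using assms(1,2)
proof (induction n arbitrary: f g)
  case (Suc n)
  have "diff_monotone n K (\<lambda>x. f x * g x - f (x + u) * g (x + u))" if u: "u \<in> K" for u
  proof -
    have "diff_monotone n K (\<lambda>x. (f x - f (x + u)) * g x + f (x + u) * (g x - g (x + u)))"
      using Suc.prems u Suc.prems[THEN diff_monotone_SucD]
      by (intro diff_monotone_add Suc.IH diff_monotone_translate assms(3)) auto
    then show ?thesis by (simp add: algebra_simps)
  qed
  then show ?case using Suc.prems by simp
qed simp

section \<open>Complete monotonicity by finite differences\<close>

lemma open_convex_cone_add:
  assumes "open_convex_cone K" "x \<in> K" "y \<in> K"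
  shows "x + y \<in> K"
proof -
  have "(1/2) *\<^sub>R x + (1/2) *\<^sub>R y \<in> K"
    using assms by (intro convexD) (auto simp: open_convex_cone_def)
  then have "2 *\<^sub>R ((1/2) *\<^sub>R x + (1/2) *\<^sub>R y) \<in> K"
    using assms(1) by (auto simp: open_convex_cone_def simp del: scaleR_add_right)
  then show ?thesis by (simp add: scaleR_add_right)
qed

text \<open>For \<open>v\<close> in \<open>K\<close> close to \<open>u\<close>, the point
  \<open>x + u - v\<close> stays in a ball around \<open>x\<close> inside \<open>K\<close>, and
  adding \<open>v\<close> back does not leave the cone.\<close>

lemma open_convex_cone_add_closure:
  assumes "open_convex_cone K" "x \<in> K" "u \<in> closure K"
  shows "x + u \<in> K"
proof -
  obtain e where e: "e > 0" "ball x e \<subseteq> K"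
    using assms(1,2) openE unfolding open_convex_cone_def by blast
  obtain v where v: "v \<in> K" "dist v u < e"
    using assms(3) e(1) closure_approachable by blast
  then have "x + u - v \<in> K"
    using e(2) by (auto simp: dist_norm norm_minus_commute algebra_simps subset_iff)
  then have "(x + u - v) + v \<in> K" using v(1) by (rule open_convex_cone_add[OF assms(1)])
  then show ?thesis by simp
qed

lemma open_convex_cone_scaleR_closure:
  assumes "open_convex_cone K" "u \<in> closure K" "c > 0"
  shows "c *\<^sub>R u \<in> closure K"
proof -
  have "(*\<^sub>R) c ` K \<subseteq> K" using assms by (auto simp: open_convex_cone_def)
  then show ?thesis using closure_scaleR[of c K] assms(2) closure_mono by blast
qed

text \<open>Steps in the closure are limits of steps in the cone, and continuity of \<open>f\<close>
  carries the inequalities over. This admits the direction of the last variable, which need not lie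
  in \<open>\<C> \<times> {0<..}\<close> but lies in its closure.\<close>

lemma diff_monotone_closure:
  assumes "open_convex_cone K" "continuous_on K f" "diff_monotone (Suc n) K f" "u \<in> closure K"
  shows "diff_monotone n K (\<lambda>x. f x - f (x + u))"
proof -
  obtain v where v: "\<And>i. v i \<in> K" "v \<longlonglongrightarrow> u" using assms(4) closure_sequential by blast
  have "((\<lambda>i. f x - f (x + v i)) \<longlonglongrightarrow> f x - f (x + u))" if "x \<in> K" for x
  proof -
    have "isCont f (x + u)"
      using assms(1,2) open_convex_cone_add_closure[OF assms(1) that assms(4)]
      by (simp add: open_convex_cone_def continuous_on_eq_continuous_at)
    then show ?thesis
      using v(2) by (intro tendsto_intros isCont_tendsto_compose[of _ f])
  qed
  then show ?thesis
    using assms(3) v(1) open_convex_cone_add[OF assms(1)]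
    by (intro diff_monotone_tendsto[of sequentially n K "\<lambda>i x. f x - f (x + v i)"]) auto
qed

text \<open>One-sided difference quotients along \<open>u\<close> are nonnegative multiples of
  differences and converge to minus the derivative, so one level is traded for one
  derivative.\<close>

lemma diff_monotone_deriv:
  assumes "open_convex_cone K" "continuous_on K f" "diff_monotone (Suc n) K f" "u \<in> closure K"
    and "\<And>x. x \<in> K \<Longrightarrow> ((\<lambda>t. f (x + t *\<^sub>R u)) has_real_derivative f' x) (at 0)"
  shows "diff_monotone n K (\<lambda>x. - f' x)"
proof (rule diff_monotone_tendsto[of "at_right 0" _ _ "\<lambda>t x. (1 / t) * (f x - f (x + t *\<^sub>R u))"])
  show "\<forall>\<^sub>F t in at_right 0. diff_monotone n K (\<lambda>x. (1 / t) * (f x - f (x + t *\<^sub>R u)))"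
    using eventually_at_right_less[of 0]
  proof eventually_elim
    case (elim t)
    then show ?case
      using assms(1-4)
      by (intro diff_monotone_cmult diff_monotone_closure open_convex_cone_scaleR_closure) auto
  qed
  show "((\<lambda>t. (1 / t) * (f x - f (x + t *\<^sub>R u))) \<longlongrightarrow> - f' x) (at_right 0)" if "x \<in> K" for x
  proof -
    have "((\<lambda>t. (f (x + t *\<^sub>R u) - f x) / t) \<longlongrightarrow> f' x) (at_right 0)"
      using assms(5)[OF that] by (auto simp: DERIV_def intro: filterlim_mono at_le)
    from tendsto_minus[OF this] show ?thesis by (simp add: diff_divide_distrib)
  qed
qed (use open_convex_cone_add[OF assms(1)] in auto)

lemma completely_monotone_onI:
  assumes "open_convex_cone K" "C_infinity_on K f" "\<And>n. diff_monotone n K f"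
  shows "completely_monotone_on K f"
proof -
  \<comment> \<open>All levels are carried along, since each further derivative uses up one; level 0
    is the desired sign condition.\<close>
  have "diff_monotone n K (\<lambda>x. (-1) ^ length us * foldr dir_deriv us f x)"
    if "set us \<subseteq> K" for us n
    using that
  proof (induction us arbitrary: n)
    case Nil
    then show ?case using assms(3) by simp
  next
    case (Cons u us)
    have smooth: "C_infinity_on K (foldr dir_deriv us f)"
      by (intro C_infinity_on_foldr_dir_deriv assms(2))
    have "diff_monotone n K (\<lambda>x. - ((-1) ^ length us * dir_deriv u (foldr dir_deriv us f) x))"
    proof (rule diff_monotone_deriv[OF assms(1)])
      show "continuous_on K (\<lambda>x. (-1) ^ length us * foldr dir_deriv us f x)"
        using smooth by (intro continuous_intros C_infinity_on_continuous_on)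
      show "diff_monotone (Suc n) K (\<lambda>x. (-1) ^ length us * foldr dir_deriv us f x)"
        using Cons by (simp del: diff_monotone.simps)
      show "u \<in> closure K" using Cons.prems closure_subset by auto
      fix x assume "x \<in> K"
      then show "((\<lambda>t. (-1) ^ length us * foldr dir_deriv us f (x + t *\<^sub>R u)) has_real_derivative
          (-1) ^ length us * dir_deriv u (foldr dir_deriv us f) x) (at 0)"
        using has_real_derivative_dir_deriv[of "foldr dir_deriv us f" x 0 u]
          C_infinity_on_differentiable[OF smooth] by (auto intro!: DERIV_cmult)
    qed
    then show ?case by simp
  qed
  from this[of _ 0] show ?thesis using assms(2) by (auto simp: completely_monotone_on_def)
qed

section \<open>From alternating derivatives to alternating differences\<close>

lemma foldr_dir_deriv_diff_translate:
  assumes "open K" "C_infinity_on K f" "\<And>x. x \<in> K \<Longrightarrow> x + u \<in> K" "x \<in> K"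
  shows "foldr dir_deriv us (\<lambda>x. f x - f (x + u)) x =
    foldr dir_deriv us f x - foldr dir_deriv us f (x + u)"
  using assms(4)
proof (induction us arbitrary: x)
  case (Cons v us)
  let ?g = "foldr dir_deriv us f"
  note diff = C_infinity_on_differentiable[OF C_infinity_on_foldr_dir_deriv[OF assms(2)], of _ us]
  have "dir_deriv v (foldr dir_deriv us (\<lambda>x. f x - f (x + u))) x =
      dir_deriv v (\<lambda>x. ?g x - ?g (x + u)) x"
    using Cons by (intro dir_deriv_cong_open[OF assms(1)]) auto
  also have "\<dots> = dir_deriv v ?g x - dir_deriv v ?g (x + u)"
    using has_real_derivative_dir_deriv[of ?g x 0 v] diff[OF Cons.prems]
      has_real_derivative_dir_deriv[of ?g "x + u" 0 v] diff[OF assms(3)[OF Cons.prems]]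
    unfolding dir_deriv_def[of v "\<lambda>x. ?g x - ?g (x + u)"]
    by (intro DERIV_imp_deriv) (auto intro!: DERIV_diff simp: ac_simps)
  finally show ?case by simp
qed simp

lemma completely_monotone_on_nonneg:
  assumes "completely_monotone_on K f" "x \<in> K"
  shows "f x \<ge> 0"
proof -
  have "(-1) ^ length [] * foldr dir_deriv [] f x \<ge> 0"
    using assms unfolding completely_monotone_on_def by (auto dest: spec[of _ "[]"])
  then show ?thesis by simp
qed

text \<open>On the segment from \<open>x\<close> to \<open>x + u\<close> each signed iterated
  derivative is nonincreasing, because its derivative along \<open>u\<close> is minus a signed
  derivative of the next order. Iterating this yields the differences of all orders.\<close>

lemma completely_monotone_on_diff:
  assumes "open_convex_cone K" "completely_monotone_on K f" "u \<in> K"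
  shows "completely_monotone_on K (\<lambda>x. f x - f (x + u))"
proof -
  have "open K" using assms(1) by (simp add: open_convex_cone_def)
  have K: "x + t *\<^sub>R u \<in> K" if "x \<in> K" "t \<ge> 0" for x t
  proof (cases "t = 0")
    case False
    then show ?thesis
      using that assms(1,3) by (auto intro!: open_convex_cone_add simp: open_convex_cone_def)
  qed (use that in simp)
  have K1: "x + u \<in> K" if "x \<in> K" for x using K[of x 1] that by simp
  have f: "C_infinity_on K f" using assms(2) by (simp add: completely_monotone_on_def)
  have "(-1) ^ length us * foldr dir_deriv us f (x + u) \<le> (-1) ^ length us * foldr dir_deriv us f x"
    if us: "set us \<subseteq> K" "x \<in> K" for us x
  proof -
    let ?g = "foldr dir_deriv us f"
    have "(-1) ^ length us * ?g (x + 1 *\<^sub>R u) \<le> (-1) ^ length us * ?g (x + 0 *\<^sub>R u)"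
    proof (rule DERIV_nonpos_imp_nonincreasing[of 0 1], simp)
      fix t :: real assume t: "0 \<le> t" "t \<le> 1"
      have "((\<lambda>t. (-1) ^ length us * ?g (x + t *\<^sub>R u)) has_real_derivative
          (-1) ^ length us * dir_deriv u ?g (x + t *\<^sub>R u)) (at t)"
        using K[OF us(2) t(1)] C_infinity_on_foldr_dir_deriv[OF f]
        by (intro DERIV_cmult has_real_derivative_dir_deriv C_infinity_on_differentiable)
      moreover have "(-1) ^ length (u # us) * foldr dir_deriv (u # us) f (x + t *\<^sub>R u) \<ge> 0"
        using assms(2,3) us K[OF us(2) t(1)] unfolding completely_monotone_on_def
        by (metis insert_subset list.simps(15))
      ultimately show "\<exists>y. ((\<lambda>t. (-1) ^ length us * ?g (x + t *\<^sub>R u)) has_real_derivative y) (at t) \<and> y \<le> 0"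
        by auto
    qed
    then show ?thesis by simp
  qed
  moreover have "C_infinity_on K (\<lambda>x. f x - f (x + u))"
    using f K1 \<open>open K\<close> by (auto simp: C_infinity_on_def intro!: C_k_on_diff C_k_on_translate)
  ultimately show ?thesis
    using foldr_dir_deriv_diff_translate[OF \<open>open K\<close> f K1]
    by (simp add: completely_monotone_on_def right_diff_distrib)
qed

lemma completely_monotone_on_imp_diff_monotone:
  assumes "open_convex_cone K" "completely_monotone_on K f"
  shows "diff_monotone n K f"
  using assms(2)
proof (induction n arbitrary: f)
  case 0
  then show ?case using completely_monotone_on_nonneg by auto
next
  case (Suc n)
  then show ?case
    using completely_monotone_on_diff[OF assms(1)] completely_monotone_on_nonneg by auto
qed

section \<open>Laplace transforms\<close>

text \<open>With \<open>c = t * (a / b + y)\<close> the base \<open>a + b * (y + n / t)\<close>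
  equals \<open>(n / t) * b * (1 + c / n)\<close>. The powers of \<open>n / t\<close> cancel, those
  of \<open>b\<close> combine to \<open>b powr (- \<beta>)\<close>, and what remains tends to
  \<open>exp (- c)\<close>.\<close>

lemma tendsto_Post_Widder:
  fixes a b c \<beta> t y :: real
  assumes "a > 0" "b > 0" "y > 0" "t > 0"
  shows "(\<lambda>n. (real n / t) powr (\<beta> + real n) * (b ^ n * (a + b * (y + real n / t)) powr (- \<beta> - real n)))
    \<longlonglongrightarrow> b powr (- \<beta>) * exp (- t * (a / b + y))"
proof -
  define c where "c = t * (a / b + y)"
  have "c > 0" using assms by (simp add: c_def add_pos_pos)
  have "(\<lambda>n. b powr (- \<beta>) * (1 + c / real n) powr (- \<beta> - real n)) \<longlonglongrightarrow> b powr (- \<beta>) * exp (- c)"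
    by (intro tendsto_mult tendsto_const) (use \<open>c > 0\<close> in real_asymp)
  moreover have "\<forall>\<^sub>F n in sequentially. b powr (- \<beta>) * (1 + c / real n) powr (- \<beta> - real n) =
     (real n / t) powr (\<beta> + real n) * (b ^ n * (a + b * (y + real n / t)) powr (- \<beta> - real n))"
    using eventually_gt_at_top[of 0]
  proof eventually_elim
    case (elim n)
    have "a + b * (y + real n / t) = real n / t * b * (1 + c / real n)"
      using assms elim by (simp add: c_def field_simps)
    moreover have "0 < real n / t" "0 \<le> 1 + c / real n" using assms elim \<open>c > 0\<close> by auto
    ultimately have *: "(a + b * (y + real n / t)) powr (- \<beta> - real n) =
        (real n / t) powr (- (\<beta> + real n)) * b powr (- \<beta> - real n) * (1 + c / real n) powr (- \<beta> - real n)"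
      using assms by (simp only: powr_mult) simp
    have **: "(real n / t) powr (\<beta> + real n) * (real n / t) powr (- (\<beta> + real n)) = 1"
      using assms(4) elim by (simp only: powr_add[symmetric]) simp
    have ***: "b ^ n * b powr (- \<beta> - real n) = b powr (- \<beta>)"
      using assms by (simp add: powr_realpow[symmetric] powr_add[symmetric])
    have "(real n / t) powr (\<beta> + real n) * (b ^ n * (a + b * (y + real n / t)) powr (- \<beta> - real n)) =
        ((real n / t) powr (\<beta> + real n) * (real n / t) powr (- (\<beta> + real n))) *
        (b ^ n * b powr (- \<beta> - real n)) * (1 + c / real n) powr (- \<beta> - real n)"
      unfolding * by (simp only: mult_ac)
    then show ?case by (simp only: ** *** mult_1)
  qed
  ultimately show ?thesis by (simp add: tendsto_cong c_def)
qed

text \<open>In the binomial series at \<open>- q\<close> with exponent \<open>- \<beta>\<close> the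
  signs of coefficient and power cancel; for positive \<open>\<beta>\<close> the resulting
  coefficients are nonnegative.\<close>

lemma negative_binomial_sums:
  fixes q \<beta> :: real
  assumes "\<bar>q\<bar> < 1"
  shows "(\<lambda>n. pochhammer \<beta> n / fact n * q ^ n) sums (1 - q) powr (- \<beta>)"
proof -
  have "((- \<beta>) gchoose n) * (- q) ^ n = ((-1) ^ n * (-1) ^ n) * (pochhammer \<beta> n / fact n * q ^ n)" for n
    by (simp add: gbinomial_pochhammer power_minus[of q])
  then have "((- \<beta>) gchoose n) * (- q) ^ n = pochhammer \<beta> n / fact n * q ^ n" for n
    by (simp flip: power_mult_distrib)
  then show ?thesis using gen_binomial_real[of "- q" "- \<beta>"] assms by simp
qed

text \<open>The function \<open>z powr (- \<beta>)\<close> is the limit as \<open>h\<close> tends to \<open>0\<close> of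
  \<open>h powr \<beta> * exp (- h * z) * (1 - exp (- h * z)) powr (- \<beta>)\<close>, and the binomial series
  expands the latter into exponentials with nonnegative coefficients. This replaces the integral
  for the Gamma function.\<close>

lemma diff_monotone_powr:
  assumes "\<And>x u. x \<in> K \<Longrightarrow> u \<in> K \<Longrightarrow> x + u \<in> K" "\<And>x. x \<in> K \<Longrightarrow> z x > 0" "\<beta> > 0"
    and "\<And>t. t > 0 \<Longrightarrow> diff_monotone n K (\<lambda>x. w x * exp (- t * z x))"
  shows "diff_monotone n K (\<lambda>x. w x * z x powr (- \<beta>))"
proof -
  let ?g = "\<lambda>h z. h powr \<beta> * exp (- h * z) * (1 - exp (- h * z)) powr (- \<beta>)"
  have "diff_monotone n K (\<lambda>x. w x * ?g h (z x))" if "h > 0" for h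
  proof (rule diff_monotone_tendsto[of sequentially])
    let ?c = "\<lambda>i. h powr \<beta> * (pochhammer \<beta> i / fact i)"
    \<comment> \<open>The prefactor \<open>exp (- h * z x)\<close> raises every rate by
      \<open>h\<close>, hence \<open>Suc i\<close>: even the term \<open>i = 0\<close> has a
      positive rate, as the assumption on the exponentials demands.\<close>
    show "\<forall>\<^sub>F N in sequentially. diff_monotone n K
        (\<lambda>x. \<Sum>i<N. ?c i * (w x * exp (- (real (Suc i) * h) * z x)))"
      using assms(3) that
      by (intro always_eventually allI diff_monotone_sum diff_monotone_cmult assms(4))
        (auto intro!: divide_nonneg_pos mult_nonneg_nonneg pochhammer_nonneg)
    fix x assume "x \<in> K"
    then have "\<bar>exp (- h * z x)\<bar> < 1" using assms(2) that by simp
    from sums_mult[OF negative_binomial_sums[OF this, of \<beta>], of "w x * h powr \<beta> * exp (- h * z x)"]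
    have "(\<lambda>i. w x * h powr \<beta> * exp (- h * z x) * (pochhammer \<beta> i / fact i * exp (- h * z x) ^ i))
      sums (w x * ?g h (z x))" by (simp add: mult_ac)
    moreover have "w x * h powr \<beta> * exp (- h * z x) * (pochhammer \<beta> i / fact i * exp (- h * z x) ^ i) =
        ?c i * (w x * exp (- (real (Suc i) * h) * z x))" for i
      by (simp add: exp_of_nat_mult[symmetric] exp_add[symmetric] algebra_simps)
    ultimately show "(\<lambda>N. \<Sum>i<N. ?c i * (w x * exp (- (real (Suc i) * h) * z x)))
      \<longlonglongrightarrow> w x * ?g h (z x)"
      by (simp only: sums_def)
  qed (use assms(1) in auto)
  then have "\<forall>\<^sub>F h in at_right 0. diff_monotone n K (\<lambda>x. w x * ?g h (z x))"
    by (rule eventually_mono[OF eventually_at_right_less[of 0]])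
  moreover have "((\<lambda>h. w x * ?g h (z x)) \<longlongrightarrow> w x * z x powr (- \<beta>)) (at_right 0)" if "x \<in> K" for x
    by (intro tendsto_mult tendsto_const) (use assms(2)[OF that] assms(3) in real_asymp)
  ultimately show ?thesis by (intro diff_monotone_tendsto[OF _ _ _ assms(1)]) auto
qed

section \<open>Inverse powers of affine functions of the last variable\<close>

lemma open_convex_cone_Times_pos:
  assumes "open_convex_cone \<C>"
  shows "open_convex_cone (\<C> \<times> {0::real<..})"
  using assms by (auto simp: open_convex_cone_def intro!: open_Times convex_Times)

text \<open>Smoothness of the coefficients has to be extracted from that of the power. Order 0
  supplies the continuity needed for taking differences in boundary directions, and all orders
  together the smoothness of the final function.\<close>

lemma C_k_on_affine_coefficients:
  fixes A B :: "'v::real_normed_vector \<Rightarrow> real"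
  assumes "open \<C>" "\<beta> \<noteq> 0" "\<And>x. x \<in> \<C> \<Longrightarrow> A x > 0" "\<And>x. x \<in> \<C> \<Longrightarrow> B x > 0"
    and "C_infinity_on (\<C> \<times> {0<..}) (\<lambda>p. (A (fst p) + B (fst p) * snd p) powr (- \<beta>))"
  shows "C_k_on k (\<C> \<times> {0::real<..}) (\<lambda>p. A (fst p))"
    and "C_k_on k (\<C> \<times> {0::real<..}) (\<lambda>p. B (fst p))"
proof -
  let ?P = "\<C> \<times> {0::real<..}" and ?S = "\<lambda>p. A (fst p) + B (fst p) * snd p"
  have P: "open ?P" using assms(1) by (simp add: open_Times)
  have pos: "?S p > 0" if "p \<in> ?P" for p using that assms(3,4) by (auto intro!: add_pos_pos)
  have S: "C_k_on k ?P ?S" for k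
  proof (rule C_k_on_cong[OF P])
    show "C_k_on k ?P (\<lambda>p. (?S p powr (- \<beta>)) powr (- 1 / \<beta>))"
    proof (rule C_k_on_powr[OF P])
      show "C_k_on k ?P (\<lambda>p. ?S p powr (- \<beta>))" using assms(5) by (simp add: C_infinity_on_def)
      show "?S p powr (- \<beta>) > 0" if "p \<in> ?P" for p using pos[OF that] by simp
    qed
    show "(?S p powr (- \<beta>)) powr (- 1 / \<beta>) = ?S p" if "p \<in> ?P" for p
      using pos[OF that] assms(2) by (simp add: powr_powr)
  qed
  have "dir_deriv (0, 1) ?S p = B (fst p)" for p
    unfolding dir_deriv_def by (rule DERIV_imp_deriv) (auto intro!: derivative_eq_intros)
  then have "dir_deriv (0, 1) ?S = (\<lambda>p. B (fst p))" by (rule ext)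
  moreover have "C_k_on k ?P (dir_deriv (0, 1) ?S)"
    using S[of "Suc k"] unfolding C_k_on.simps by blast
  ultimately show B: "C_k_on k ?P (\<lambda>p. B (fst p))" by simp
  have "C_k_on k ?P (\<lambda>p. ?S p - B (fst p) * snd p)"
    by (intro C_k_on_diff C_k_on_mult P S B C_k_on_bounded_linear bounded_linear_snd)
  then show "C_k_on k ?P (\<lambda>p. A (fst p))" by simp
qed

text \<open>Translating along the last variable by \<open>n / t\<close> in the Post-Widder inversion formula
  keeps the factor \<open>exp (- t * snd p)\<close>, so that all functions live on the same cone.\<close>

lemma diff_monotone_exp:
  fixes A B :: "'v::real_normed_vector \<Rightarrow> real"
  assumes "open_convex_cone \<C>" "\<beta> > 0" "\<And>x. x \<in> \<C> \<Longrightarrow> A x > 0" "\<And>x. x \<in> \<C> \<Longrightarrow> B x > 0"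
    and "completely_monotone_on (\<C> \<times> {0<..}) (\<lambda>p. (A (fst p) + B (fst p) * snd p) powr (- \<beta>))"
    and "t > 0"
  shows "diff_monotone m (\<C> \<times> {0<..})
    (\<lambda>p. B (fst p) powr (- \<beta>) * exp (- t * (A (fst p) / B (fst p) + snd p)))"
proof (cases "\<C> = {}")
  case True
  then have "\<C> \<times> {0::real<..} = {}" by simp
  then show ?thesis by (cases m) auto
next
  case False
  let ?P = "\<C> \<times> {0::real<..}" and ?S = "\<lambda>p. A (fst p) + B (fst p) * snd p"
  \<comment> \<open>On \<open>?P\<close>, \<open>?G n\<close> is \<open>(-1) ^ n\<close> times the
    n-th derivative of \<open>?S p powr (- \<beta>)\<close> in the last variable, divided by the
    positive number \<open>pochhammer \<beta> n\<close>.\<close>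
  let ?G = "\<lambda>n p. B (fst p) ^ n * ?S p powr (- \<beta> - real n)"
  have P: "open_convex_cone ?P" using assms(1) by (rule open_convex_cone_Times_pos)
  have "open \<C>" using assms(1) by (simp add: open_convex_cone_def)
  have pos: "?S p > 0" if "p \<in> ?P" for p using that assms(3,4) by (auto intro!: add_pos_pos)
  have cont: "continuous_on ?P (\<lambda>p. A (fst p))" "continuous_on ?P (\<lambda>p. B (fst p))"
    using C_k_on_affine_coefficients[where A = A and B = B and \<beta> = \<beta> and k = 0, OF \<open>open \<C>\<close> _ assms(3,4)] assms(2,5)
    by (auto simp: completely_monotone_on_def)
  \<comment> \<open>A point of the nonempty cone is scaled towards 0; this places the direction
    \<open>(0, 1)\<close> in the closure of \<open>?P\<close>.\<close>
  have "0 \<in> closure \<C>"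
  proof -
    obtain w where "w \<in> \<C>" using False by blast
    then have "(1 / real (Suc i)) *\<^sub>R w \<in> \<C>" for i using assms(1) by (simp add: open_convex_cone_def)
    moreover have "(\<lambda>i. (1 / real (Suc i)) *\<^sub>R w) \<longlonglongrightarrow> 0 *\<^sub>R w"
      by (intro tendsto_intros) real_asymp
    ultimately show ?thesis
      unfolding closure_sequential by (intro exI[of _ "\<lambda>i. (1 / real (Suc i)) *\<^sub>R w"]) simp
  qed
  then have e: "(0, 1) \<in> closure ?P" by (simp add: closure_Times)
  have G: "diff_monotone m ?P (?G n)" for n m
  proof (induction n arbitrary: m)
    case 0
    then show ?case using completely_monotone_on_imp_diff_monotone[OF P assms(5)] by simp
  next
    case (Suc n)
    let ?r = "- \<beta> - real n"
    \<comment> \<open>Differentiating \<open>?G n\<close> in the last variable gives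
      \<open>?G (Suc n)\<close> times \<open>- (\<beta> + real n)\<close>, and this constant is
      divided out afterwards. The lost level is harmless, as the induction hypothesis holds at every
      level.\<close>
    have "diff_monotone m ?P (\<lambda>p. - (- ((\<beta> + real n) * ?G (Suc n) p)))"
    proof (rule diff_monotone_deriv[OF P _ Suc.IH e])
      show "continuous_on ?P (?G n)"
      proof (intro continuous_intros cont ballI)
        show "?S p \<noteq> 0" if "p \<in> ?P" for p using pos[OF that] by simp
      qed
      fix p assume p: "p \<in> ?P"
      have "((\<lambda>s. ?S p + B (fst p) * s) has_real_derivative B (fst p)) (at 0)"
        by (auto intro!: derivative_eq_intros)
      from DERIV_cmult[OF DERIV_fun_powr[OF this, of ?r], of "B (fst p) ^ n"] pos[OF p]
      have "((\<lambda>s. B (fst p) ^ n * (?S p + B (fst p) * s) powr ?r) has_real_derivative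
        B (fst p) ^ n * (?r * ?S p powr (?r - 1) * B (fst p))) (at 0)" by simp
      moreover have "B (fst p) ^ n * (?r * ?S p powr (?r - 1) * B (fst p)) =
        - ((\<beta> + real n) * ?G (Suc n) p)"
      proof -
        have *: "?r - 1 = - \<beta> - real (Suc n)" by simp
        show ?thesis unfolding * by (simp add: algebra_simps)
      qed
      ultimately show "((\<lambda>s. ?G n (p + s *\<^sub>R (0, 1))) has_real_derivative
          - ((\<beta> + real n) * ?G (Suc n) p)) (at 0)"
        by (simp add: distrib_left add.assoc)
    qed
    from diff_monotone_cmult[OF this, of "1 / (\<beta> + real n)"]
    have "diff_monotone m ?P (\<lambda>p. (1 / (\<beta> + real n)) * ((\<beta> + real n) * ?G (Suc n) p))"
      using assms(2) by (simp only: minus_minus) simp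
    moreover have "\<beta> + real n \<noteq> 0" using assms(2) by linarith
    ultimately show ?case by simp
  qed
  \<comment> \<open>The shift need not lie in \<open>?P\<close>; it suffices that it maps
    \<open>?P\<close> into itself, also for \<open>n = 0\<close>, where it vanishes.\<close>
  have shift: "diff_monotone m ?P (\<lambda>p. ?G n (p + (0, real n / t)))" for n
  proof (rule diff_monotone_translate[OF G])
    show "p + (0, real n / t) \<in> ?P" if "p \<in> ?P" for p
      using that assms(6) by (cases p) (simp add: add_pos_nonneg)
  qed
  show ?thesis
  proof (rule diff_monotone_tendsto[of sequentially])
    show "\<forall>\<^sub>F n in sequentially. diff_monotone m ?P
        (\<lambda>p. (real n / t) powr (\<beta> + real n) * ?G n (p + (0, real n / t)))"
      by (intro always_eventually allI diff_monotone_cmult shift) simp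
    show "(\<lambda>n. (real n / t) powr (\<beta> + real n) * ?G n (p + (0, real n / t))) \<longlonglongrightarrow>
      B (fst p) powr (- \<beta>) * exp (- t * (A (fst p) / B (fst p) + snd p))" if "p \<in> ?P" for p
      using tendsto_Post_Widder[of "A (fst p)" "B (fst p)" "snd p" t \<beta>] that assms(3,4,6)
      by (simp add: mem_Times_iff)
  qed (use open_convex_cone_add[OF P] in auto)
qed

theorem proposition3p5:
  fixes \<C> :: "'v::real_normed_vector set"
    and A B C D :: "'v \<Rightarrow> real"
    and \<beta> :: real
  assumes "\<exists>b. finite_dimensional_vector_space (scaleR :: real \<Rightarrow> 'v \<Rightarrow> 'v) b"
    and "open_convex_cone \<C>"
    and "\<beta> > 0"
    and "\<And>x. x \<in> \<C> \<Longrightarrow> A x > 0"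
    and "\<And>x. x \<in> \<C> \<Longrightarrow> B x > 0"
    and "\<And>x. x \<in> \<C> \<Longrightarrow> C x > 0"
    and "\<And>x. x \<in> \<C> \<Longrightarrow> D x > 0"
    and "completely_monotone_on (\<C> \<times> {0<..}) (\<lambda>(x, y). (A x + B x * y) powr (- \<beta>))"
    and "completely_monotone_on (\<C> \<times> {0<..}) (\<lambda>(x, y). (C x + D x * y) powr (- \<beta>))"
  shows "completely_monotone_on (\<C> \<times> {0<..})
    (\<lambda>(x, y). (A x * D x + B x * C x + B x * D x * y) powr (- \<beta>))"
proof -
  let ?P = "\<C> \<times> {0::real<..}"
  let ?a = "\<lambda>p. A (fst p)" and ?b = "\<lambda>p. B (fst p)" and ?c = "\<lambda>p. C (fst p)" and ?d = "\<lambda>p. D (fst p)"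
  \<comment> \<open>The target is \<open>r = 1\<close>. A product of two exponentials contains the
    last variable twice and so leads to \<open>r = 2\<close> first.\<close>
  let ?E = "\<lambda>r p. ?a p * ?d p + ?b p * ?c p + ?b p * ?d p * (r * snd p)"
  have P: "open_convex_cone ?P" using assms(2) by (rule open_convex_cone_Times_pos)
  note P_add = open_convex_cone_add[OF P]
  have "open ?P" using P unfolding open_convex_cone_def by blast
  have "open \<C>" using assms(2) unfolding open_convex_cone_def by blast
  have pos: "?a p > 0" "?b p > 0" "?c p > 0" "?d p > 0" "snd p > 0" if "p \<in> ?P" for p
    using that assms(4-7) by auto
  have AB: "completely_monotone_on ?P (\<lambda>p. (?a p + ?b p * snd p) powr (- \<beta>))"
    and CD: "completely_monotone_on ?P (\<lambda>p. (?c p + ?d p * snd p) powr (- \<beta>))"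
    using assms(8,9) by (simp_all add: case_prod_unfold)

  have "C_k_on k ?P ?a" "C_k_on k ?P ?b" "C_k_on k ?P ?c" "C_k_on k ?P ?d" for k
    using C_k_on_affine_coefficients[where A = A and B = B and \<beta> = \<beta>, OF \<open>open \<C>\<close> _ assms(4,5)]
      C_k_on_affine_coefficients[where A = C and B = D and \<beta> = \<beta>, OF \<open>open \<C>\<close> _ assms(6,7)]
      AB CD assms(3)
    by (simp_all add: completely_monotone_on_def)
  then have "C_k_on k ?P (?E 1)" for k
    by (intro C_k_on_add C_k_on_mult \<open>open ?P\<close> C_k_on_bounded_linear[OF bounded_linear_snd] C_k_on_const)
  then have smooth: "C_infinity_on ?P (\<lambda>p. ?E 1 p powr (- \<beta>))"
    unfolding C_infinity_on_def
    by (intro allI C_k_on_powr[OF \<open>open ?P\<close>]) (auto intro!: add_pos_pos mult_pos_pos assms(4-7))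

  have dm: "diff_monotone n ?P (\<lambda>p. ?E 2 p powr (- \<beta>))" for n
  proof -
    \<comment> \<open>The sum of the two exponents without the factor \<open>- t\<close>; multiplied
      by \<open>?b p * ?d p\<close> it becomes \<open>?E 2 p\<close>.\<close>
    let ?z = "\<lambda>p. ?a p / ?b p + ?c p / ?d p + 2 * snd p"
    have "diff_monotone n ?P (\<lambda>p. (?b p * ?d p) powr (- \<beta>) * ?z p powr (- \<beta>))"
    proof (rule diff_monotone_powr[OF P_add _ assms(3)])
      show "?z p > 0" if "p \<in> ?P" for p
        using pos[OF that] by (intro add_pos_pos) auto
      fix t :: real assume "t > 0"
      from diff_monotone_mult[OF diff_monotone_exp[where A = A and B = B, OF assms(2-5) AB this]
          diff_monotone_exp[where A = C and B = D, OF assms(2,3,6,7) CD this] P_add]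
      have "diff_monotone n ?P (\<lambda>p. (?b p powr (- \<beta>) * exp (- t * (?a p / ?b p + snd p))) *
        (?d p powr (- \<beta>) * exp (- t * (?c p / ?d p + snd p))))" .
      then show "diff_monotone n ?P (\<lambda>p. (?b p * ?d p) powr (- \<beta>) * exp (- t * ?z p))"
      proof (rule diff_monotone_cong[OF _ _ P_add])
        fix p assume "p \<in> ?P"
        have "exp (- t * ?z p) = exp (- t * (?a p / ?b p + snd p)) * exp (- t * (?c p / ?d p + snd p))"
          by (simp add: exp_add[symmetric] algebra_simps)
        then show "(?b p powr (- \<beta>) * exp (- t * (?a p / ?b p + snd p))) *
          (?d p powr (- \<beta>) * exp (- t * (?c p / ?d p + snd p))) = (?b p * ?d p) powr (- \<beta>) * exp (- t * ?z p)"
          using pos[OF \<open>p \<in> ?P\<close>] by (simp add: powr_mult)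
      qed
    qed
    then show ?thesis
    proof (rule diff_monotone_cong[OF _ _ P_add])
      fix p assume p: "p \<in> ?P"
      have "?E 2 p = (?b p * ?d p) * ?z p" using pos[OF p] by (simp add: field_simps)
      moreover have "?z p > 0" using pos[OF p] by (intro add_pos_pos) auto
      ultimately show "(?b p * ?d p) powr (- \<beta>) * ?z p powr (- \<beta>) = ?E 2 p powr (- \<beta>)"
        using pos[OF p] by (simp only: powr_mult[symmetric] mult_nonneg_nonneg less_imp_le)
    qed
  qed
  \<comment> \<open>Halving the last coordinate preserves the cone and turns \<open>?E 2\<close>
    into \<open>?E 1\<close>.\<close>
  have "diff_monotone n ?P (\<lambda>p. ?E 1 p powr (- \<beta>))" for n
    using diff_monotone_linear_comp[OF dm[of n], of "\<lambda>p. (fst p, snd p / 2)"]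
    by (auto simp: add_divide_distrib)
  from completely_monotone_onI[OF P smooth this] show ?thesis by (simp add: case_prod_unfold)
qed

end
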